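(* Let $G$ be a finite simple graph with no isolated vertices that is not isomorphic to any of the following graphs, each built on a path $P$ with vertices $r,s,t,u$ and edges $rs,st,tu$: (1) $P$ plus a vertex adjacent exactly to $r$ and $u$ (i.e. $C_5$); (2) $P$ plus a vertex adjacent exactly to $r,s,u$; (3) $P$ plus a vertex $v$ adjacent exactly to $r,s,u$ and a vertex $w$ adjacent exactly to $r,t,u$, with $v,w$ nonadjacent; (4) for any integer $k\ge 0$: $P$ plus $k$ pairwise nonadjacent vertices, each adjacent exactly to $r$ and $t$; (5) for any integer $k\ge 0$: $P$ plus $k$ pairwise nonadjacent vertices, each adjacent exactly to $r,s,t,u$. Then $G$ is $P_4$-free if and only if $G/e$ is $P_4$-free for every edge $e\in E(G)$.
   Context: All graphs are finite and simple. $P_4$ is the path on four vertices. A graph is $H$-free if it has no induced subgraph isomorphic to $H$. For an edge $e=uv$ of $G$, the contraction $G/e$ is obtained from $G$ by deleting $u$ and $v$ and adding a new vertex adjacent to every vertex of $(N(u)\cup N(v))\setminus\{u,v\}$. *)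

theory Defs
  imports "Graph_Theory.Graph_Theory"
begin

text \<open>
  A finite simple graph is a \<^locale>\<open>pair_graph\<close>: a finite, loop-free, symmetric digraph
  without parallel arcs, in which an undirected edge is a pair of opposite arcs.
\<close>

definition sym_graph :: "'a set \<Rightarrow> 'a rel \<Rightarrow> 'a pair_pre_digraph" where
  "sym_graph V E = \<lparr> pverts = V, parcs = E \<union> E\<inverse> \<rparr>"

text \<open>
  \<open>induced_free F G\<close>: no induced subgraph of \<open>G\<close> is isomorphic to \<open>F\<close>.
\<close>

definition induced_free :: "'b pair_pre_digraph \<Rightarrow> 'a pair_pre_digraph \<Rightarrow> bool" where
  "induced_free F G \<longleftrightarrow>
    (\<nexists>H. induced_subgraph H (with_proj G) \<and> digraph_iso H (with_proj F))"

definition no_isolated :: "'a pair_pre_digraph \<Rightarrow> bool" where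
  "no_isolated G \<longleftrightarrow> (\<forall>v \<in> pverts G. \<exists>w. (v, w) \<in> parcs G)"

text \<open>
  Contraction of the edge \<open>e\<close>. The vertex type is extended by \<open>None\<close>, which serves as the new
  vertex; the result is the same for the two arcs representing an edge.
\<close>

definition contract_edge :: "'a pair_pre_digraph \<Rightarrow> 'a \<times> 'a \<Rightarrow> 'a option pair_pre_digraph" where
  "contract_edge G e =
    (let W = pverts G - {fst e, snd e} in
     sym_graph (insert None (Some ` W))
       ({(Some x, Some y) | x y. x \<in> W \<and> y \<in> W \<and> (x, y) \<in> parcs G} \<union>
        {(None, Some y) | y. y \<in> W \<and> ((fst e, y) \<in> parcs G \<or> (snd e, y) \<in> parcs G)}))"

datatype path_vertex = Vr | Vs | Vt | Vu | Extra nat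

definition P4_graph :: "path_vertex pair_pre_digraph" where
  "P4_graph = sym_graph {Vr, Vs, Vt, Vu} {(Vr, Vs), (Vs, Vt), (Vt, Vu)}"

text \<open>
  The path together with \<open>k\<close> pairwise nonadjacent vertices \<open>Extra 0, \<dots>, Extra (k - 1)\<close>, where
  \<open>Extra i\<close> is adjacent exactly to the vertices in \<open>N i\<close>, for \<open>N i \<subseteq> {Vr, Vs, Vt, Vu}\<close>.
\<close>

definition P4_plus :: "nat \<Rightarrow> (nat \<Rightarrow> path_vertex set) \<Rightarrow> path_vertex pair_pre_digraph" where
  "P4_plus k N =
    sym_graph (pverts P4_graph \<union> Extra ` {..<k})
      (parcs P4_graph \<union> {(Extra i, x) | i x. i < k \<and> x \<in> N i})"

inductive exceptional :: "path_vertex pair_pre_digraph \<Rightarrow> bool" where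
  "exceptional (P4_plus 1 (\<lambda>_. {Vr, Vu}))"
| "exceptional (P4_plus 1 (\<lambda>_. {Vr, Vs, Vu}))"
| "exceptional (P4_plus 2 (\<lambda>i. if i = 0 then {Vr, Vs, Vu} else {Vr, Vt, Vu}))"
| "exceptional (P4_plus k (\<lambda>_. {Vr, Vt}))"
| "exceptional (P4_plus k (\<lambda>_. {Vr, Vs, Vt, Vu}))"

lemma pair_graph_sym_graph:
  assumes "finite V" "E \<subseteq> V \<times> V" "irrefl E"
  shows "pair_graph (sym_graph V E)"
proof -
  have "finite E" using assms by (meson finite_SigmaI finite_subset)
  then show ?thesis
    using assms by unfold_locales
      (auto simp: sym_graph_def symmetric_def irrefl_def intro!: symI)
qed

lemma pair_graph_P4_graph: "pair_graph P4_graph"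
  unfolding P4_graph_def by (rule pair_graph_sym_graph) (auto simp: irrefl_def)

lemma pair_graph_P4_plus:
  assumes "\<And>i. i < k \<Longrightarrow> N i \<subseteq> {Vr, Vs, Vt, Vu}"
  shows "pair_graph (P4_plus k N)"
  unfolding P4_plus_def using assms
  by (intro pair_graph_sym_graph) (fastforce simp: irrefl_def P4_graph_def sym_graph_def)+

lemma pair_graph_exceptional: "exceptional X \<Longrightarrow> pair_graph X"
  by (erule exceptional.cases) (auto intro!: pair_graph_P4_plus split: if_splits)

lemma pair_graph_contract_edge:
  assumes "pair_graph G"
  shows "pair_graph (contract_edge G e)"
proof -
  interpret pair_graph G by fact
  show ?thesis
    unfolding contract_edge_def Let_def
    by (rule pair_graph_sym_graph) (auto simp: irrefl_def dest: no_loops')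
qed

lemma contract_edge_swap: "contract_edge G (v, u) = contract_edge G (u, v)"
  by (simp add: contract_edge_def insert_commute disj_commute)

end

theory Submission
  imports Defs
begin

text \<open>
  An induced path of \<open>G/e\<close> through the contracted vertex lifts to one of \<open>G\<close>, by putting an end of
  \<open>e\<close>, or the edge \<open>e\<close> itself, in place of that vertex. Conversely, let \<open>r s t u\<close> be an induced path
  of \<open>G\<close> although no contraction contains one. Contracting an edge disjoint from an induced path
  preserves that path, so every edge meets every induced \<open>P\<^sub>4\<close>; in particular the vertices outside
  \<open>{r, s, t, u}\<close> are independent. Contracting an edge \<open>vx\<close> to a path vertex \<open>x\<close> preserves the path
  whenever \<open>N(v) \<subseteq> N[x]\<close>, which leaves the neighbourhoods \<open>rt, su, ru, rsu, rtu, rstu\<close> for an outer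
  vertex. Contracting \<open>rs\<close> (or \<open>tu\<close>) shows that all outer vertices agree on \<open>u\<close> (and on \<open>r\<close>), and
  applying the disjoint-edge principle to the paths \<open>r v u t\<close> and \<open>s t u v\<close> leaves only the
  exceptional graphs.
\<close>

section \<open>Isomorphisms of digraphs whose arcs are pairs of vertices\<close>

lemma digraph_iso_with_projI:
  assumes "pair_wf_digraph G" "pair_wf_digraph H"
    and bij: "bij_betw f (pverts G) (pverts H)"
    and arcs: "\<And>x y. x \<in> pverts G \<Longrightarrow> y \<in> pverts G \<Longrightarrow> (f x, f y) \<in> parcs H \<longleftrightarrow> (x, y) \<in> parcs G"
  shows "digraph_iso (with_proj G) (with_proj H)"
proof -
  interpret G: pair_wf_digraph G by fact
  interpret H: pair_wf_digraph H by fact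
  \<comment> \<open>Arcs are pairs of vertices, so the vertex map \<open>f\<close> alone determines
    the arc map.\<close>
  let ?h = "\<lparr> iso_verts = f, iso_arcs = map_prod f f, iso_head = snd, iso_tail = fst \<rparr>"
  have inj: "inj_on f (pverts G)" and img: "f ` pverts G = pverts H"
    using bij by (auto simp: bij_betw_def)
  have "inj_on (map_prod f f) (parcs G)"
    by (rule inj_on_subset[OF map_prod_inj_on[OF inj inj]]) (auto dest: G.wellformed')
  moreover have "map_prod f f ` parcs G = parcs H"
  proof
    show "map_prod f f ` parcs G \<subseteq> parcs H"
      using arcs by (auto dest: G.wellformed')
    show "parcs H \<subseteq> map_prod f f ` parcs G"
    proof (rule subrelI)
      fix a b assume ab: "(a, b) \<in> parcs H"
      then have "a \<in> f ` pverts G" "b \<in> f ` pverts G"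
        using img by (auto dest: H.wellformed')
      then show "(a, b) \<in> map_prod f f ` parcs G"
        using arcs ab by force
    qed
  qed
  ultimately have "pre_digraph.digraph_isomorphism (with_proj G) ?h"
    and "with_proj H = app_iso ?h (with_proj G)"
    using inj img G.wf_digraph_axioms
    by (auto simp: pre_digraph.digraph_isomorphism_def app_iso_def with_proj_def)
  then show ?thesis
    unfolding digraph_iso_def by blast
qed

text \<open>Since the arcs of \<open>F\<close> are pairs, the image of an arc must be the pair of
  the images of its two ends.\<close>

lemma digraph_iso_with_projD:
  assumes "digraph_iso H (with_proj F)"
  obtains f where "inj_on f (verts H)" "f ` verts H = pverts F"
    "parcs F = (\<lambda>e. (f (tail H e), f (head H e))) ` arcs H"
proof -
  obtain h where h: "pre_digraph.digraph_isomorphism H h" and F: "with_proj F = app_iso h H"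
    using assms by (auto simp: digraph_iso_def)
  from F have *: "iso_tail h = fst" "iso_head h = snd" "pverts F = iso_verts h ` verts H"
    "parcs F = iso_arcs h ` arcs H"
    by (auto simp: app_iso_def with_proj_def)
  have "iso_arcs h e = (iso_verts h (tail H e), iso_verts h (head H e))" if "e \<in> arcs H" for e
    using h that * by (auto simp: pre_digraph.digraph_isomorphism_def prod_eq_iff)
  then show thesis
    using h * by (intro that[of "iso_verts h"])
      (auto simp: pre_digraph.digraph_isomorphism_def image_iff)
qed

text \<open>
  In a \<^locale>\<open>pair_graph\<close> the six conditions already force the four vertices to be distinct.
\<close>

definition induced_P4 :: "'a pair_pre_digraph \<Rightarrow> 'a \<Rightarrow> 'a \<Rightarrow> 'a \<Rightarrow> 'a \<Rightarrow> bool" where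
  "induced_P4 G a b c d \<longleftrightarrow>
    (a, b) \<in> parcs G \<and> (b, c) \<in> parcs G \<and> (c, d) \<in> parcs G \<and>
    (a, c) \<notin> parcs G \<and> (a, d) \<notin> parcs G \<and> (b, d) \<notin> parcs G"

text \<open>Lets the recognition lemma for \<open>P4_plus\<close> serve for the bare path as
  well.\<close>

lemma P4_plus_0: "P4_plus 0 N = P4_graph"
  by (auto simp: P4_plus_def P4_graph_def sym_graph_def)

section \<open>Induced paths as vertex quadruples\<close>

context pair_graph
begin

lemma parcs_commute: "(x, y) \<in> parcs G \<longleftrightarrow> (y, x) \<in> parcs G"
  using arcs_symmetric by blast

lemma induced_P4_rev: "induced_P4 G a b c d \<Longrightarrow> induced_P4 G d c b a"
  unfolding induced_P4_def using parcs_commute by blast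

lemma induced_P4_distinct: "induced_P4 G a b c d \<Longrightarrow> distinct [a, b, c, d]"
  unfolding induced_P4_def using parcs_commute no_loops' by auto

lemma induced_P4_verts: "induced_P4 G a b c d \<Longrightarrow> {a, b, c, d} \<subseteq> pverts G"
  unfolding induced_P4_def using wellformed' by auto

lemma induced_P4_arcs:
  assumes "induced_P4 G r s t u"
  shows
    "(r, s) \<in> parcs G" "(s, t) \<in> parcs G" "(t, u) \<in> parcs G"
    "(s, r) \<in> parcs G" "(t, s) \<in> parcs G" "(u, t) \<in> parcs G"
    "(r, t) \<notin> parcs G" "(r, u) \<notin> parcs G" "(s, u) \<notin> parcs G"
    "(t, r) \<notin> parcs G" "(u, r) \<notin> parcs G" "(u, s) \<notin> parcs G"
  using assms parcs_commute unfolding induced_P4_def by blast+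

lemma digraph_iso_P4_plus:
  assumes path: "induced_P4 G r s t u"
    and verts: "pverts G = {r, s, t, u} \<union> g ` {..<k}"
    and g: "inj_on g {..<k}" "g ` {..<k} \<inter> {r, s, t, u} = {}"
    and indep: "\<And>i j. i < k \<Longrightarrow> j < k \<Longrightarrow> (g i, g j) \<notin> parcs G"
    and N: "\<And>i. i < k \<Longrightarrow> N i \<subseteq> {Vr, Vs, Vt, Vu}"
    and adj: "\<And>i. i < k \<Longrightarrow> (g i, r) \<in> parcs G \<longleftrightarrow> Vr \<in> N i"
      "\<And>i. i < k \<Longrightarrow> (g i, s) \<in> parcs G \<longleftrightarrow> Vs \<in> N i"
      "\<And>i. i < k \<Longrightarrow> (g i, t) \<in> parcs G \<longleftrightarrow> Vt \<in> N i"
      "\<And>i. i < k \<Longrightarrow> (g i, u) \<in> parcs G \<longleftrightarrow> Vu \<in> N i"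
  shows "digraph_iso (with_proj G) (with_proj (P4_plus k N))"
proof -
  let ?P = "P4_plus k N"
  \<comment> \<open>The map goes from the model to \<open>G\<close>, where cases on the constructors
    define it at once; symmetry of isomorphism turns it around at the end.\<close>
  let ?f = "case_path_vertex r s t u g"
  interpret P: pair_graph ?P
    by (rule pair_graph_P4_plus) (rule N)
  have vP: "pverts ?P = {Vr, Vs, Vt, Vu} \<union> Extra ` {..<k}"
    by (simp add: P4_plus_def P4_graph_def sym_graph_def)
  have bij: "bij_betw ?f (pverts ?P) (pverts G)"
    unfolding bij_betw_def
  proof
    show "inj_on ?f (pverts ?P)"
      unfolding vP using induced_P4_distinct[OF path] g
      by (auto simp: inj_on_def)
    show "?f ` pverts ?P = pverts G"
      unfolding vP verts by (auto simp: image_image image_Un)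
  qed
  have adj': "(x, g i) \<in> parcs G \<longleftrightarrow> (g i, x) \<in> parcs G" if "x \<in> {r, s, t, u}" for x i
    by (rule parcs_commute)
  have arcs: "(?f x, ?f y) \<in> parcs G \<longleftrightarrow> (x, y) \<in> parcs ?P"
    if "x \<in> pverts ?P" "y \<in> pverts ?P" for x y
    using that adj indep unfolding vP
    by (cases x; cases y)
      (auto simp: P4_plus_def P4_graph_def sym_graph_def induced_P4_arcs[OF path] adj'
        dest: no_loops' subsetD[OF N])
  have "digraph_iso (with_proj ?P) (with_proj G)"
    by (rule digraph_iso_with_projI[OF _ _ bij arcs]) unfold_locales
  then show ?thesis
    by (rule digraph_iso_swap[OF P.wf_digraph_axioms])
qed

text \<open>Replaces isomorphism by four named vertices, the form in which paths are handled from
  here on.\<close>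

lemma induced_free_P4_iff:
  "induced_free P4_graph G \<longleftrightarrow> (\<nexists>a b c d. induced_P4 G a b c d)"
proof -
  have "\<exists>a b c d. induced_P4 G a b c d"
    if H: "induced_subgraph H (with_proj G)" and iso: "digraph_iso H (with_proj P4_graph)" for H
  proof -
    from iso obtain f where f: "inj_on f (verts H)" "f ` verts H = pverts P4_graph"
      "parcs P4_graph = (\<lambda>e. (f (tail H e), f (head H e))) ` arcs H"
      by (rule digraph_iso_with_projD)
    have H': "tail H = fst" "head H = snd"
      "arcs H = {e \<in> parcs G. fst e \<in> verts H \<and> snd e \<in> verts H}"
      using H by (auto simp: induced_subgraph_def subgraph_def compatible_def)
    have "{Vr, Vs, Vt, Vu} = f ` verts H"
      using f(2) by (simp add: P4_graph_def sym_graph_def)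
    then obtain r s t u where v: "r \<in> verts H" "s \<in> verts H" "t \<in> verts H" "u \<in> verts H"
      "f r = Vr" "f s = Vs" "f t = Vt" "f u = Vu"
      by (smt (verit) image_iff insertCI)
    \<comment> \<open>\<open>H\<close> is induced and \<open>f\<close> is injective, so arcs are
      reflected as well as preserved.\<close>
    have "(x, y) \<in> parcs G \<longleftrightarrow> (f x, f y) \<in> parcs P4_graph" if "x \<in> verts H" "y \<in> verts H" for x y
      using that f(1) unfolding f(3) H' by (auto simp: image_iff dest: inj_onD)
    then have "induced_P4 G r s t u"
      using v by (auto simp: induced_P4_def P4_graph_def sym_graph_def)
    then show ?thesis by blast
  qed
  moreover have "\<exists>H. induced_subgraph H (with_proj G) \<and> digraph_iso H (with_proj P4_graph)"
    if path: "induced_P4 G a b c d" for a b c d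
  proof -
    define W where "W = {a, b, c, d}"
    define H where "H = \<lparr> pverts = W, parcs = parcs G \<inter> W \<times> W \<rparr>"
    have W: "W \<subseteq> pverts G"
      using induced_P4_verts[OF path] by (simp add: W_def)
    interpret H: pair_graph H
      using finite_subset[OF W] by unfold_locales
        (auto simp: H_def symmetric_def intro: symI dest: no_loops' arcs_symmetric)
    have "induced_subgraph (with_proj H) (with_proj G)"
      using W H.wf_digraph_axioms wf_digraph_axioms
      by (auto simp: induced_subgraph_def subgraph_def compatible_def H_def)
    moreover have "induced_P4 H a b c d"
      using path by (auto simp: induced_P4_def H_def W_def)
    then have "digraph_iso (with_proj H) (with_proj (P4_plus 0 (\<lambda>_. {})))"
      by (rule H.digraph_iso_P4_plus) (auto simp: H_def W_def)
    ultimately show ?thesis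
      unfolding P4_plus_0 by blast
  qed
  ultimately show ?thesis
    unfolding induced_free_def by blast
qed

section \<open>Lifting induced paths from a contraction\<close>

lemma parcs_contract_edge_iffs:
  "(Some a, Some b) \<in> parcs (contract_edge G (x, y)) \<longleftrightarrow>
    a \<notin> {x, y} \<and> b \<notin> {x, y} \<and> (a, b) \<in> parcs G"
  "(None, Some b) \<in> parcs (contract_edge G (x, y)) \<longleftrightarrow>
    b \<notin> {x, y} \<and> ((x, b) \<in> parcs G \<or> (y, b) \<in> parcs G)"
  "(Some b, None) \<in> parcs (contract_edge G (x, y)) \<longleftrightarrow>
    b \<notin> {x, y} \<and> ((x, b) \<in> parcs G \<or> (y, b) \<in> parcs G)"
  "(None, None) \<notin> parcs (contract_edge G (x, y))"
  by (auto simp: contract_edge_def sym_graph_def Let_def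
      dest: wellformed' arcs_symmetric)

lemma induced_P4_of_contract_edge:
  assumes xy: "(x, y) \<in> parcs G" and P: "induced_P4 (contract_edge G (x, y)) a b c d"
  shows "\<exists>a b c d. induced_P4 G a b c d"
proof -
  let ?C = "contract_edge G (x, y)"
  interpret C: pair_graph ?C
    by (rule pair_graph_contract_edge) (rule pair_graph)
  have yx: "(y, x) \<in> parcs G"
    using xy arcs_symmetric by blast
  \<comment> \<open>Whichever of \<open>x\<close>, \<open>y\<close> is adjacent to \<open>b\<close>
    can take the place of \<open>None\<close>.\<close>
  have end_case: ?thesis if "induced_P4 ?C None (Some b) (Some c) (Some d)" for b c d
    using that unfolding induced_P4_def parcs_contract_edge_iffs by blast
  have mid_case: ?thesis if *: "induced_P4 ?C (Some a) None (Some c) (Some d)" for a c d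
  proof -
    \<comment> \<open>If one end of the edge sees both \<open>a\<close> and \<open>c\<close>, it
      replaces \<open>None\<close>. Otherwise \<open>a\<close> and \<open>c\<close> are seen by
      different ends, and the edge itself links them; \<open>d\<close> is then dropped.\<close>
    have "induced_P4 G a x c d \<or> induced_P4 G a y c d \<or> induced_P4 G a x y c \<or> induced_P4 G a y x c"
      using * xy yx parcs_commute
      unfolding induced_P4_def parcs_contract_edge_iffs by metis
    then show ?thesis by blast
  qed
  have dist: "distinct [a, b, c, d]"
    using P by (rule C.induced_P4_distinct)
  consider "a = None" | "b = None" | "c = None" | "d = None" | "None \<notin> {a, b, c, d}"
    by auto
  then show ?thesis
  proof cases
    case 1 then show ?thesis using P dist
      by (cases a; cases b; cases c; cases d) (auto intro: end_case)
  next
    case 2 then show ?thesis using P dist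
      by (cases a; cases b; cases c; cases d) (auto intro: mid_case)
  next
    case 3 then show ?thesis using C.induced_P4_rev[OF P] dist
      by (cases a; cases b; cases c; cases d) (auto intro: mid_case)
  next
    case 4 then show ?thesis using C.induced_P4_rev[OF P] dist
      by (cases a; cases b; cases c; cases d) (auto intro: end_case)
  next
    case 5
    then obtain a' b' c' d' where "a = Some a'" "b = Some b'" "c = Some c'" "d = Some d'"
      by (cases a; cases b; cases c; cases d) auto
    then show ?thesis
      using P unfolding induced_P4_def by (auto simp: parcs_contract_edge_iffs)
  qed
qed

end

section \<open>Consequences of P4-free contractions\<close>

locale P4_free_contractions = pair_graph +
  assumes contract_P4_free: "e \<in> parcs G \<Longrightarrow> induced_free P4_graph (contract_edge G e)"
begin

lemma no_induced_P4_contract_edge: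
  assumes "(x, y) \<in> parcs G"
  shows "\<not> induced_P4 (contract_edge G (x, y)) a b c d"
proof -
  interpret C: pair_graph "contract_edge G (x, y)"
    by (rule pair_graph_contract_edge) (rule pair_graph)
  show ?thesis
    using contract_P4_free[OF assms] by (auto simp: C.induced_free_P4_iff)
qed

lemma edge_meets_P4:
  assumes "induced_P4 G a b c d" "(x, y) \<in> parcs G"
  shows "{x, y} \<inter> {a, b, c, d} \<noteq> {}"
  using no_induced_P4_contract_edge[OF assms(2), of "Some a" "Some b" "Some c" "Some d"] assms(1)
  by (auto simp: induced_P4_def parcs_contract_edge_iffs)

text \<open>The path excluded here is \<open>None\<close>, \<open>a\<close>, \<open>b\<close>,
  \<open>c\<close> in the contraction, with its adjacencies read back in \<open>G\<close>.\<close>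

lemma not_P4_end:
  assumes "(x, y) \<in> parcs G" "{x, y} \<inter> {a, b, c} = {}"
    and "(x, a) \<in> parcs G \<or> (y, a) \<in> parcs G"
    and "(a, b) \<in> parcs G" "(b, c) \<in> parcs G" "(a, c) \<notin> parcs G"
    and "(x, b) \<notin> parcs G" "(y, b) \<notin> parcs G" "(x, c) \<notin> parcs G" "(y, c) \<notin> parcs G"
  shows False
  using no_induced_P4_contract_edge[OF assms(1), of None "Some a" "Some b" "Some c"] assms
  by (auto simp: induced_P4_def parcs_contract_edge_iffs)

text \<open>The contracted vertex is now inner: the excluded path is \<open>a\<close>,
  \<open>None\<close>, \<open>b\<close>, \<open>c\<close>.\<close>

lemma not_P4_mid:
  assumes "(x, y) \<in> parcs G" "{x, y} \<inter> {a, b, c} = {}"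
    and "(x, a) \<in> parcs G \<or> (y, a) \<in> parcs G" "(x, b) \<in> parcs G \<or> (y, b) \<in> parcs G"
    and "(b, c) \<in> parcs G" "(a, b) \<notin> parcs G" "(a, c) \<notin> parcs G"
    and "(x, c) \<notin> parcs G" "(y, c) \<notin> parcs G"
  shows False
  using no_induced_P4_contract_edge[OF assms(1), of "Some a" None "Some b" "Some c"] assms
  by (auto simp: induced_P4_def parcs_contract_edge_iffs)

end

section \<open>Vertices off a fixed induced path\<close>

locale P4_in_P4_free_contractions = P4_free_contractions +
  fixes r s t u
  assumes path: "induced_P4 G r s t u"
    and no_isolated: "no_isolated G"
begin

definition outer :: "'a set" where
  "outer = pverts G - {r, s, t, u}"

text \<open>Reversing the path preserves all assumptions, so facts with a mirror image are proved
  once and transferred by this instance.\<close>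

lemma rev: "P4_in_P4_free_contractions G u t s r"
  using path no_isolated by unfold_locales (auto intro: induced_P4_rev)

lemma outer_rev: "P4_in_P4_free_contractions.outer G u t s r = outer"
  by (auto simp: outer_def P4_in_P4_free_contractions.outer_def[OF rev])

lemmas path_arcs = induced_P4_arcs[OF path]

lemma path_distinct: "distinct [r, s, t, u]"
  using path by (rule induced_P4_distinct)

lemma outer_independent: "v \<in> outer \<Longrightarrow> w \<in> outer \<Longrightarrow> (v, w) \<notin> parcs G"
  using edge_meets_P4[OF path, of v w] by (auto simp: outer_def)

lemma outer_neighbour:
  assumes "v \<in> outer"
  shows "(v, r) \<in> parcs G \<or> (v, s) \<in> parcs G \<or> (v, t) \<in> parcs G \<or> (v, u) \<in> parcs G"
proof -
  obtain w where w: "(v, w) \<in> parcs G"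
    using assms no_isolated by (auto simp: outer_def no_isolated_def)
  then have "w \<notin> outer"
    using outer_independent[OF assms] by blast
  then show ?thesis
    using w by (auto simp: outer_def dest: wellformed')
qed

text \<open>Otherwise contracting \<open>vr\<close> keeps the path, with the merged vertex in the
  role of \<open>r\<close>.\<close>

lemma outer_adj_r:
  assumes "v \<in> outer" "(v, r) \<in> parcs G"
  shows "(v, t) \<in> parcs G \<or> (v, u) \<in> parcs G"
  using assms not_P4_end[of v r s t u] path_arcs path_distinct
  by (auto simp: outer_def)

text \<open>Otherwise contracting \<open>vs\<close> keeps the path: edges from \<open>v\<close> to
  \<open>r\<close> or \<open>t\<close> are harmless, as the merged vertex sees both anyway.\<close>

lemma outer_adj_s:
  assumes "v \<in> outer" "(v, s) \<in> parcs G"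
  shows "(v, u) \<in> parcs G"
  using assms not_P4_mid[of v s r t u] path_arcs path_distinct
  by (auto simp: outer_def)

lemmas outer_adj_u = P4_in_P4_free_contractions.outer_adj_r[OF rev, unfolded outer_rev]
lemmas outer_adj_t = P4_in_P4_free_contractions.outer_adj_s[OF rev, unfolded outer_rev]

lemma outer_adj_u_cong:
  assumes "v \<in> outer" "w \<in> outer" "(w, u) \<in> parcs G"
  shows "(v, u) \<in> parcs G"
proof (rule ccontr)
  assume v: "(v, u) \<notin> parcs G"
  \<comment> \<open>If \<open>v\<close> sees \<open>t\<close>, it also sees \<open>r\<close>; for
    \<open>w\<close>, adjacency to \<open>u\<close> forces \<open>r\<close> or
    \<open>s\<close>.\<close>
  have "(v, r) \<in> parcs G \<or> (v, s) \<in> parcs G" "(w, r) \<in> parcs G \<or> (w, s) \<in> parcs G"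
    using outer_neighbour outer_adj_t outer_adj_u assms v by blast+
  then show False
    \<comment> \<open>Contracting \<open>rs\<close> creates the induced path \<open>v\<close>,
      \<open>None\<close>, \<open>w\<close>, \<open>u\<close>.\<close>
    using not_P4_mid[of r s v w u] outer_independent[of v w] assms v path_arcs path_distinct
    by (auto simp: outer_def parcs_commute[of r v] parcs_commute[of s v] parcs_commute[of r w] parcs_commute[of s w])
qed

lemmas outer_adj_r_cong = P4_in_P4_free_contractions.outer_adj_u_cong[OF rev, unfolded outer_rev]

text \<open>Without the edge \<open>vt\<close>, the path \<open>r\<close>, \<open>v\<close>,
  \<open>u\<close>, \<open>t\<close> is induced and misses the edge \<open>ws\<close>.\<close>

lemma outer_adj_s_imp_t:
  assumes "v \<in> outer" "w \<in> outer" "v \<noteq> w"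
    and "(v, r) \<in> parcs G" "(v, u) \<in> parcs G" "(w, s) \<in> parcs G"
  shows "(v, t) \<in> parcs G"
proof (rule ccontr)
  assume "(v, t) \<notin> parcs G"
  then have "induced_P4 G r v u t"
    using assms path_arcs by (auto simp: induced_P4_def parcs_commute[of r v])
  from edge_meets_P4[OF this assms(6)] show False
    using assms path_distinct by (auto simp: outer_def)
qed

lemmas outer_adj_t_imp_s =
  P4_in_P4_free_contractions.outer_adj_s_imp_t[OF rev, unfolded outer_rev]

text \<open>The path \<open>s\<close>, \<open>t\<close>, \<open>u\<close>, \<open>v\<close> is
  induced, and an edge \<open>wr\<close> would miss it.\<close>

lemma outer_ru_unique:
  assumes "v \<in> outer" "w \<in> outer" "v \<noteq> w"
    and "(v, u) \<in> parcs G" "(v, s) \<notin> parcs G" "(v, t) \<notin> parcs G"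
  shows "(w, r) \<notin> parcs G"
proof
  assume wr: "(w, r) \<in> parcs G"
  have "induced_P4 G s t u v"
    using assms path_arcs by (auto simp: induced_P4_def parcs_commute[of u v] parcs_commute[of t v] parcs_commute[of s v])
  from edge_meets_P4[OF this wr] show False
    using assms path_distinct by (auto simp: outer_def)
qed

section \<open>Recognition of the exceptional graphs\<close>

lemma outer_uniform_iso:
  assumes N: "N \<subseteq> {Vr, Vs, Vt, Vu}"
    and adj: "\<And>v. v \<in> outer \<Longrightarrow> ((v, r) \<in> parcs G \<longleftrightarrow> Vr \<in> N) \<and> ((v, s) \<in> parcs G \<longleftrightarrow> Vs \<in> N) \<and>
      ((v, t) \<in> parcs G \<longleftrightarrow> Vt \<in> N) \<and> ((v, u) \<in> parcs G \<longleftrightarrow> Vu \<in> N)"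
  shows "digraph_iso (with_proj G) (with_proj (P4_plus (card outer) (\<lambda>_. N)))"
proof -
  have "finite outer"
    by (simp add: outer_def)
  \<comment> \<open>Any enumeration works, since the outer vertices are independent and share one
    neighbourhood.\<close>
  then obtain g where "bij_betw g {..<card outer} outer"
    using ex_bij_betw_nat_finite lessThan_atLeast0 by metis
  then have g: "inj_on g {..<card outer}" "g ` {..<card outer} = outer"
    by (auto simp: bij_betw_def)
  then have go: "g i \<in> outer" if "i < card outer" for i
    using that by blast
  show ?thesis
    using induced_P4_verts[OF path] path adj[OF go] g outer_independent[OF go go] N
    by (intro digraph_iso_P4_plus[where g = g]) (auto simp: outer_def)
qed

lemma outer_singleton_iso:
  assumes "outer = {v}" "N \<subseteq> {Vr, Vs, Vt, Vu}"
    and "(v, r) \<in> parcs G \<longleftrightarrow> Vr \<in> N" "(v, s) \<in> parcs G \<longleftrightarrow> Vs \<in> N"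
      "(v, t) \<in> parcs G \<longleftrightarrow> Vt \<in> N" "(v, u) \<in> parcs G \<longleftrightarrow> Vu \<in> N"
  shows "digraph_iso (with_proj G) (with_proj (P4_plus 1 (\<lambda>_. N)))"
  using outer_uniform_iso[of N] assms by auto

text \<open>No outer vertex sees \<open>u\<close>, hence none sees \<open>s\<close>; then
  \<open>r\<close> and \<open>t\<close> force each other, and having a neighbour at all forces
  both.\<close>

lemma exceptional_rt:
  assumes v: "v \<in> outer" "(v, u) \<notin> parcs G"
  shows "\<exists>X. exceptional X \<and> digraph_iso (with_proj G) (with_proj X)"
proof -
  have "(w, u) \<notin> parcs G" if "w \<in> outer" for w
    using outer_adj_u_cong[OF v(1) that] v(2) by blast
  then have "digraph_iso (with_proj G) (with_proj (P4_plus (card outer) (\<lambda>_. {Vr, Vt})))"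
    by (intro outer_uniform_iso)
      (use outer_neighbour outer_adj_r outer_adj_s outer_adj_t in blast)+
  then show ?thesis
    using exceptional.intros(4) by blast
qed

lemma exceptional_rsu:
  assumes v: "v \<in> outer" and ru: "\<And>w. w \<in> outer \<Longrightarrow> (w, r) \<in> parcs G \<and> (w, u) \<in> parcs G"
    and vs: "(v, s) \<in> parcs G" and vt: "(v, t) \<notin> parcs G"
  shows "\<exists>X. exceptional X \<and> digraph_iso (with_proj G) (with_proj X)"
proof (cases "outer = {v}")
  case True
  then have "digraph_iso (with_proj G) (with_proj (P4_plus 1 (\<lambda>_. {Vr, Vs, Vu})))"
    by (rule outer_singleton_iso) (use assms in auto)
  then show ?thesis
    using exceptional.intros(2) by blast
next
  case False
  then obtain w where w: "w \<in> outer" "w \<noteq> v"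
    using v by blast
  \<comment> \<open>Since \<open>v\<close> sees \<open>s\<close>, \<open>x\<close> must see
    \<open>t\<close>; were \<open>x\<close> to see \<open>s\<close>, then \<open>v\<close> would see
    \<open>t\<close>.\<close>
  have other: "(x, t) \<in> parcs G \<and> (x, s) \<notin> parcs G" if "x \<in> outer" "x \<noteq> v" for x
    using outer_adj_s_imp_t ru v vs vt that by blast
  \<comment> \<open>Two distinct outer vertices that both see \<open>t\<close> would also see
    \<open>s\<close>.\<close>
  have "x = w" if "x \<in> outer" "x \<noteq> v" for x
    using outer_adj_t_imp_s[of x w] other ru that w by blast
  then have outer: "outer = {v, w}"
    using v w by blast
  let ?N = "\<lambda>i::nat. if i = 0 then {Vr, Vs, Vu} else {Vr, Vt, Vu}"
  have "digraph_iso (with_proj G) (with_proj (P4_plus 2 ?N))"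
  proof (rule digraph_iso_P4_plus[where g = "\<lambda>i. if i = 0 then v else w"])
    show "pverts G = {r, s, t, u} \<union> (\<lambda>i. if i = 0 then v else w) ` {..<2::nat}"
      using outer induced_P4_verts[OF path] by (auto simp: outer_def lessThan_Suc numeral_2_eq_2)
  qed (use path v w vs vt ru other outer_independent outer_def in
      \<open>auto simp: inj_on_def less_2_cases_iff lessThan_Suc numeral_2_eq_2 split: if_splits\<close>)
  then show ?thesis
    using exceptional.intros(3) by blast
qed

lemma exceptional_iso: "\<exists>X. exceptional X \<and> digraph_iso (with_proj G) (with_proj X)"
proof -
  interpret R: P4_in_P4_free_contractions G u t s r
    by (rule rev)
  show ?thesis
  proof (cases "\<forall>v \<in> outer. (v, r) \<in> parcs G \<and> (v, u) \<in> parcs G")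
    case False
    then show ?thesis
      \<comment> \<open>An outer vertex missing \<open>r\<close> is covered by reading the path
        backwards.\<close>
      using exceptional_rt R.exceptional_rt unfolding outer_rev by blast
  next
    case ru: True
    show ?thesis
    proof (cases "\<forall>v \<in> outer. (v, s) \<in> parcs G \<and> (v, t) \<in> parcs G")
      case True
      \<comment> \<open>This includes an empty \<open>outer\<close>, where \<open>G\<close> is the
        path itself.\<close>
      then have "digraph_iso (with_proj G) (with_proj (P4_plus (card outer) (\<lambda>_. {Vr, Vs, Vt, Vu})))"
        using ru by (intro outer_uniform_iso) auto
      then show ?thesis
        using exceptional.intros(5) by blast
    next
      case False
      then obtain v where v: "v \<in> outer" "\<not> ((v, s) \<in> parcs G \<and> (v, t) \<in> parcs G)"
        by blast
      consider "(v, s) \<in> parcs G" "(v, t) \<notin> parcs G" | "(v, t) \<in> parcs G" "(v, s) \<notin> parcs G"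
        | "(v, s) \<notin> parcs G" "(v, t) \<notin> parcs G"
        using v by blast
      then show ?thesis
      proof cases
        case 1
        then show ?thesis using exceptional_rsu ru v by blast
      next
        case 2
        then show ?thesis using R.exceptional_rsu ru v unfolding outer_rev by blast
      next
        case 3
        \<comment> \<open>Any other outer vertex would see \<open>r\<close>, which
          \<open>outer_ru_unique\<close> forbids.\<close>
        then have "outer = {v}"
          using outer_ru_unique ru v by blast
        then have "digraph_iso (with_proj G) (with_proj (P4_plus 1 (\<lambda>_. {Vr, Vu})))"
          by (rule outer_singleton_iso) (use 3 ru v in auto)
        then show ?thesis
          using exceptional.intros(1) by blast
      qed
    qed
  qed
qed

end

theorem theorem28:
  fixes G :: "'a pair_pre_digraph"
  assumes "pair_graph G"
    and "no_isolated G"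
    and "\<And>X. exceptional X \<Longrightarrow> \<not> digraph_iso (with_proj G) (with_proj X)"
  shows "induced_free P4_graph G \<longleftrightarrow> (\<forall>e \<in> parcs G. induced_free P4_graph (contract_edge G e))"
proof -
  interpret pair_graph G by fact
  show ?thesis
  proof
    assume free: "induced_free P4_graph G"
    show "\<forall>e \<in> parcs G. induced_free P4_graph (contract_edge G e)"
    proof
      fix e assume e: "e \<in> parcs G"
      obtain x y where xy: "e = (x, y)" by (cases e)
      interpret C: pair_graph "contract_edge G (x, y)"
        by (rule pair_graph_contract_edge) (rule assms(1))
      show "induced_free P4_graph (contract_edge G e)"
        using free e induced_P4_of_contract_edge
        by (auto simp: C.induced_free_P4_iff induced_free_P4_iff xy)
    qed
  next
    assume contr: "\<forall>e \<in> parcs G. induced_free P4_graph (contract_edge G e)"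
    show "induced_free P4_graph G"
    proof (rule ccontr)
      assume "\<not> induced_free P4_graph G"
      then obtain r s t u where "induced_P4 G r s t u"
        unfolding induced_free_P4_iff by blast
      then interpret P4_in_P4_free_contractions G r s t u
        using contr assms(2) by unfold_locales auto
      show False
        using exceptional_iso assms(3) by blast
    qed
  qed
qed

end
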